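(* Consider the time scale $\mathbb{T}=\mathbb{Z}$ with $a=0$ and $b=n$, where $n\ge 1$ is an integer, and write $f(k)=x_k$ for real numbers $x_0,x_1,\dots,x_n$. In this case $h_k(t,s)=\binom{t-s}{k}$ for all $t,s\in\mathbb{Z}$, and therefore $$h_2(t,0)=\binom{t}{2}=\frac{t(t-1)}{2},\qquad h_2(t,n)=\binom{t-n}{2}=\frac{(t-n)(t-n-1)}{2}.$$ Let $\gamma,\Gamma\in\mathbb{R}$ satisfy $\gamma\le\Delta x_i\le\Gamma$ for $i=0,1,\dots,n-1$. Then for all $i=1,\dots,n$, $$\left|x_i-\frac1n\sum_{j=1}^n x_j-\frac{x_n}{n}\left(i-\frac{n+1}{2}\right)\right|\le\frac14\, n(\Gamma-\gamma).$$
   Context: $\Delta x_i=x_{i+1}-x_i$ is the forward difference, which is the delta derivative on $\mathbb{T}=\mathbb{Z}$. The functions $h_k:\mathbb{T}^2\to\mathbb{R}$, $k\in\mathbb{N}_0$, are defined by $h_0(t,s)=1$ and, recursively, $h_{k+1}(t,s)=\int_s^t h_k(\tau,s)\,\Delta\tau$ for all $s,t\in\mathbb{T}$. On $\mathbb{Z}$ the delta integral is $\int_s^t g(\tau)\,\Delta\tau=\sum_{\tau=s}^{t-1}g(\tau)$ for $s\le t$, with $\int_s^t=-\int_t^s$ for $s>t$.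
   Formalization: The slope x_n/n in the inequality is replaced by (x_n − x_0)/n; as printed the bound fails, e.g. for n=2, x_0=x_1=x_2=1, γ=Γ=0, i=1, and the two forms agree when x_0=0. *)

theory Defs
  imports Complex_Main
begin

definition delta_integral :: "int \<Rightarrow> int \<Rightarrow> (int \<Rightarrow> real) \<Rightarrow> real" where
  "delta_integral s t g =
     (if s \<le> t then (\<Sum>\<tau>\<in>{s..<t}. g \<tau>) else - (\<Sum>\<tau>\<in>{t..<s}. g \<tau>))"

primrec h :: "nat \<Rightarrow> int \<Rightarrow> int \<Rightarrow> real" where
  "h 0 t s = 1"
| "h (Suc k) t s = delta_integral s t (\<lambda>\<tau>. h k \<tau> s)"

definition forward_diff :: "(nat \<Rightarrow> real) \<Rightarrow> nat \<Rightarrow> real" where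
  "forward_diff x i = x (i + 1) - x i"

text \<open>
  The slope in the Ostrowski--Gruess bound has to be $(x_n - x_0)/n$: with $x_n/n$ in its place the
  bound fails for a nonzero constant sequence.
\<close>

lemma bound_fails_without_initial_value:
  "\<not> (\<forall>n\<ge>1. \<forall>(x :: nat \<Rightarrow> real) \<gamma> \<Gamma>.
        (\<forall>i\<in>{0..n - 1}. \<gamma> \<le> forward_diff x i \<and> forward_diff x i \<le> \<Gamma>) \<longrightarrow>
        (\<forall>i\<in>{1..n}.
           \<bar>x i - (1 / real n) * (\<Sum>j = 1..n. x j)
              - (x n / real n) * (real i - (real n + 1) / 2)\<bar>
           \<le> (1 / 4) * real n * (\<Gamma> - \<gamma>)))"
proof
  assume "\<forall>n\<ge>1. \<forall>(x :: nat \<Rightarrow> real) \<gamma> \<Gamma>.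
        (\<forall>i\<in>{0..n - 1}. \<gamma> \<le> forward_diff x i \<and> forward_diff x i \<le> \<Gamma>) \<longrightarrow>
        (\<forall>i\<in>{1..n}.
           \<bar>x i - (1 / real n) * (\<Sum>j = 1..n. x j)
              - (x n / real n) * (real i - (real n + 1) / 2)\<bar>
           \<le> (1 / 4) * real n * (\<Gamma> - \<gamma>))"
  from this[rule_format, of 2 0 "\<lambda>_. 1" 0 1] show False
    by (simp add: forward_diff_def)
qed

end

theory Submission imports Defs begin

text \<open>
  For the binomial formula, Pascal's rule exhibits \<open>(\<tau> - s) gchoose k\<close> as a forward difference, so
  the delta integrals telescope.

  The bound already holds before averaging over \<open>j\<close>. For \<open>j \<le> i\<close> put \<open>D = i - j\<close>,
  \<open>\<delta> = x\<^sub>i - x\<^sub>j\<close> and \<open>T = x\<^sub>n - x\<^sub>0\<close>. Here \<open>\<delta>\<close> is a sum of \<open>D\<close> forward differences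
  and \<open>T - \<delta>\<close> is the sum of the remaining \<open>n - D\<close>, so
  \<open>n \<delta> - T D = (n - D) \<delta> - D (T - \<delta>)\<close> is at most
  \<open>D (n - D) (\<Gamma> - \<gamma>) \<le> n\<^sup>2 (\<Gamma> - \<gamma>) / 4\<close> in absolute value.
\<close>

lemma delta_integral_telescope:
  "delta_integral s t (\<lambda>\<tau>. F (\<tau> + 1) - F \<tau>) = F t - F s"
proof -
  have le: "(\<Sum>\<tau>\<in>{a..<b}. F (\<tau> + 1) - F \<tau>) = F b - F a" if "a \<le> b" for a b :: int
    using that
  proof (induction b rule: int_ge_induct)
    case (step b)
    have "{a..<b + 1} = insert b {a..<b}" using step.hyps by auto
    then show ?case using step.IH by simp
  qed simp
  \<comment> \<open>For \<open>s > t\<close> the sum runs over \<open>{t..<s}\<close> and gives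
    \<open>F s - F t\<close>; the minus sign in \<open>delta_integral\<close> turns this into
    \<open>F t - F s\<close>.\<close>
  show ?thesis by (auto simp: delta_integral_def le)
qed

lemma h_eq_gbinomial: "h k t s = of_int (t - s) gchoose k"
proof (induction k arbitrary: t)
  case (Suc k)
  let ?F = "\<lambda>\<tau>. (of_int (\<tau> - s) :: real) gchoose Suc k"
  have "h k \<tau> s = ?F (\<tau> + 1) - ?F \<tau>" for \<tau>
    using gbinomial_Suc_Suc[of "of_int (\<tau> - s) :: real" k] by (simp add: Suc.IH algebra_simps)
  then have "h (Suc k) t s = delta_integral s t (\<lambda>\<tau>. ?F (\<tau> + 1) - ?F \<tau>)" by simp
  also have "\<dots> = ?F t - ?F s" by (rule delta_integral_telescope)
  \<comment> \<open>The boundary term \<open>?F s\<close> is \<open>0 gchoose Suc k\<close>, which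
    vanishes.\<close>
  finally show ?case by simp
qed simp

lemma gbinomial_2: "(a :: real) gchoose 2 = a * (a - 1) / 2"
  by (simp add: gbinomial_prod_rev eval_nat_numeral)

text \<open>Telescoping: each step from \<open>m\<close> to \<open>m + 1\<close> adds one forward
  difference, which lies between \<gamma> and \<Gamma>.\<close>

lemma increment_bounds:
  assumes "\<And>k. k < n \<Longrightarrow> \<gamma> \<le> forward_diff x k \<and> forward_diff x k \<le> \<Gamma>"
    and "i \<le> j" "j \<le> n"
  shows "\<gamma> * (real j - real i) \<le> x j - x i" "x j - x i \<le> \<Gamma> * (real j - real i)"
proof -
  have "\<gamma> * (real j - real i) \<le> x j - x i \<and> x j - x i \<le> \<Gamma> * (real j - real i)"
    using assms(2,3)
  proof (induction j rule: dec_induct)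
    case (step m)
    then show ?case using assms(1)[of m] by (auto simp: forward_diff_def algebra_simps)
  qed simp
  then show "\<gamma> * (real j - real i) \<le> x j - x i" "x j - x i \<le> \<Gamma> * (real j - real i)" by auto
qed

lemma chord_deviation_ordered:
  assumes diff: "\<And>k. k < n \<Longrightarrow> \<gamma> \<le> forward_diff x k \<and> forward_diff x k \<le> \<Gamma>"
    and "n \<ge> 1" "j \<le> i" "i \<le> n"
  shows "\<bar>x i - x j - (x n - x 0) / real n * (real i - real j)\<bar> \<le> real n * (\<Gamma> - \<gamma>) / 4"
proof -
  define N D \<delta> \<epsilon> where "N = real n" and "D = real i - real j" and "\<delta> = x i - x j"
    and "\<epsilon> = x n - x 0 - (x i - x j)"
  have D: "0 \<le> D" "0 \<le> N - D" and N: "N > 0"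
    using assms(2-) by (auto simp: N_def D_def)
  have \<delta>: "\<gamma> * D \<le> \<delta>" "\<delta> \<le> \<Gamma> * D"
    using increment_bounds[OF diff, of n j i] assms(3,4) by (auto simp: \<delta>_def D_def)
  \<comment> \<open>Here \<epsilon> is \<open>(x j - x 0) + (x n - x i)\<close>, so the bounds on
    the index ranges before \<open>j\<close> and after \<open>i\<close> add up.\<close>
  have \<epsilon>: "\<gamma> * (N - D) \<le> \<epsilon>" "\<epsilon> \<le> \<Gamma> * (N - D)"
    using increment_bounds[OF diff, of n 0 j] increment_bounds[OF diff, of n i n] assms(3,4)
    by (auto simp: \<epsilon>_def N_def D_def algebra_simps)
  have "\<gamma> \<le> \<Gamma>" using diff[of 0] assms(2) by auto
  \<comment> \<open>The expansion of \<open>(N - 2 * D)\<^sup>2 \<ge> 0\<close>.\<close>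
  have "4 * (D * (N - D)) \<le> N\<^sup>2"
    using zero_le_power2[of "N - 2 * D"] by (simp add: power2_eq_square algebra_simps)
  then have max: "4 * (D * (N - D)) * (\<Gamma> - \<gamma>) \<le> N\<^sup>2 * (\<Gamma> - \<gamma>)"
    using \<open>\<gamma> \<le> \<Gamma>\<close> by (intro mult_right_mono) auto
  \<comment> \<open>With \<open>P = D * (N - D)\<close>, both products lie between
    \<open>\<gamma> * P\<close> and \<open>\<Gamma> * P\<close>, so they differ by at most the
    length of that interval.\<close>
  have "\<bar>(N - D) * \<delta> - D * \<epsilon>\<bar> \<le> D * (N - D) * (\<Gamma> - \<gamma>)"
    using mult_left_mono[OF \<delta>(1) D(2)] mult_left_mono[OF \<delta>(2) D(2)]
      mult_left_mono[OF \<epsilon>(1) D(1)] mult_left_mono[OF \<epsilon>(2) D(1)]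
    by (auto simp: abs_le_iff algebra_simps)
  with max have "\<bar>(N - D) * \<delta> - D * \<epsilon>\<bar> \<le> N\<^sup>2 * (\<Gamma> - \<gamma>) / 4" by simp
  then have "\<bar>(N - D) * \<delta> - D * \<epsilon>\<bar> / N \<le> N * (\<Gamma> - \<gamma>) / 4"
    using N by (simp add: field_simps power2_eq_square)
  moreover have "x i - x j - (x n - x 0) / real n * (real i - real j) = ((N - D) * \<delta> - D * \<epsilon>) / N"
  proof -
    have "x n - x 0 = \<delta> + \<epsilon>" by (simp add: \<delta>_def \<epsilon>_def)
    then show ?thesis
      using N unfolding \<delta>_def[symmetric] D_def[symmetric] N_def[symmetric]
      by (simp add: field_simps)
  qed
  ultimately show ?thesis using N by (simp add: N_def)
qed

text \<open>Swapping \<open>i\<close> and \<open>j\<close> only changes the sign of the deviation,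
  so the ordered case suffices.\<close>

lemma chord_deviation:
  assumes diff: "\<And>k. k < n \<Longrightarrow> \<gamma> \<le> forward_diff x k \<and> forward_diff x k \<le> \<Gamma>"
    and "n \<ge> 1" "i \<le> n" "j \<le> n"
  shows "\<bar>x i - x j - (x n - x 0) / real n * (real i - real j)\<bar> \<le> real n * (\<Gamma> - \<gamma>) / 4"
proof (cases "j \<le> i")
  case True
  then show ?thesis using chord_deviation_ordered[OF diff] assms(2-) by simp
next
  case False
  have "x i - x j - (x n - x 0) / real n * (real i - real j)
      = - (x j - x i - (x n - x 0) / real n * (real j - real i))"
    by (simp add: right_diff_distrib)
  then show ?thesis
    using chord_deviation_ordered[OF diff, of n i j] False assms(2-) by (simp only: abs_minus_cancel)
qed

text \<open>Averaging over \<open>j\<close>: the mean of \<open>real i - real j\<close> for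
  \<open>j = 1..n\<close> is \<open>real i - (real n + 1) / 2\<close>, so the left side is the
  absolute value of a mean of chord deviations that all obey the same bound.\<close>

lemma mean_deviation:
  assumes diff: "\<And>k. k < n \<Longrightarrow> \<gamma> \<le> forward_diff x k \<and> forward_diff x k \<le> \<Gamma>"
    and "n \<ge> 1" "i \<le> n"
  shows "\<bar>x i - (1 / real n) * (\<Sum>j = 1..n. x j)
      - ((x n - x 0) / real n) * (real i - (real n + 1) / 2)\<bar> \<le> (1 / 4) * real n * (\<Gamma> - \<gamma>)"
    (is "\<bar>?L\<bar> \<le> _")
proof -
  define S where "S = (x n - x 0) / real n"
  define f where "f j = x i - x j - S * (real i - real j)" for j
  have gauss: "(\<Sum>j = 1..n. real j) = real n * (real n + 1) / 2"
    by (induction n) (auto simp: field_simps)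
  have "sum f {1..n} = real n * x i - (\<Sum>j = 1..n. x j) - S * (real n * real i - (\<Sum>j = 1..n. real j))"
    by (simp add: f_def sum_subtractf flip: sum_distrib_left)
  also have "\<dots> = real n * ?L"
    using \<open>n \<ge> 1\<close> unfolding gauss S_def[symmetric] by (simp add: field_simps)
  finally have "real n * \<bar>?L\<bar> = \<bar>sum f {1..n}\<bar>" by (simp add: abs_mult)
  also have "\<dots> \<le> (\<Sum>j = 1..n. \<bar>f j\<bar>)" by (rule sum_abs)
  also have "\<dots> \<le> (\<Sum>j = 1..n. real n * (\<Gamma> - \<gamma>) / 4)"
    using chord_deviation[OF diff] assms(2,3) by (intro sum_mono) (simp add: f_def S_def)
  also have "\<dots> = real n * ((1 / 4) * real n * (\<Gamma> - \<gamma>))" by simp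
  finally show ?thesis using \<open>n \<ge> 1\<close> by simp
qed

theorem corollary2:
  fixes n :: nat
  assumes "n \<ge> 1"
  shows "(\<forall>k t s. h k t s = (of_int (t - s) :: real) gchoose k) \<and>
    (\<forall>t. h 2 t 0 = (of_int t :: real) gchoose 2 \<and>
         (of_int t :: real) gchoose 2 = of_int t * (of_int t - 1) / 2) \<and>
    (\<forall>t. h 2 t (int n) = (of_int (t - int n) :: real) gchoose 2 \<and>
         (of_int (t - int n) :: real) gchoose 2
           = (of_int t - real n) * (of_int t - real n - 1) / 2) \<and>
    (\<forall>(x :: nat \<Rightarrow> real) \<gamma> \<Gamma>.
       (\<forall>i\<in>{0..n - 1}. \<gamma> \<le> forward_diff x i \<and> forward_diff x i \<le> \<Gamma>) \<longrightarrow>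
       (\<forall>i\<in>{1..n}.
          \<bar>x i - (1 / real n) * (\<Sum>j = 1..n. x j)
             - ((x n - x 0) / real n) * (real i - (real n + 1) / 2)\<bar>
          \<le> (1 / 4) * real n * (\<Gamma> - \<gamma>)))"
proof (intro conjI allI impI ballI)
  fix x :: "nat \<Rightarrow> real" and \<gamma> \<Gamma> i
  assume "\<forall>i\<in>{0..n - 1}. \<gamma> \<le> forward_diff x i \<and> forward_diff x i \<le> \<Gamma>" and "i \<in> {1..n}"
  \<comment> \<open>Since \<open>n \<ge> 1\<close>, truncated subtraction does no harm:
    \<open>{0..n - 1}\<close> consists exactly of the \<open>k < n\<close>.\<close>
  then show "\<bar>x i - (1 / real n) * (\<Sum>j = 1..n. x j)
      - ((x n - x 0) / real n) * (real i - (real n + 1) / 2)\<bar> \<le> (1 / 4) * real n * (\<Gamma> - \<gamma>)"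
    using assms by (intro mean_deviation) auto
qed (simp_all add: h_eq_gbinomial gbinomial_2 del: h.simps)

end
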